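(* Let $m\ge2$. If $\{B_i : 1\leq i\leq m\}$ is an $(n,m;k_1,k_2,\dots,k_m;\lambda_1,\lambda_2,\dots,\lambda_m)$-GSEDF, then $\{B_i : 1\leq i\leq m\}$ is an $(n,m,(k_1,k_2,\dots,k_m),a,\lambda)$-SWEDF, where $a=\sum_{i}k_i$, $\widetilde{k}=\mathrm{lcm}(k_1,\dots,k_m)$ and $\lambda=\sum_{1\leq i\leq m}\frac{\lambda_i\widetilde{k}}{k_i}$.
   Context: Let $G$ be an additive Abelian group of order $n$ with identity $0$. For multi-sets $B_1,B_2$ of elements of $G$, $D(B_1,B_2)$ is the multi-set $\{x-y : x\in B_1,\ y\in B_2\}$; $c\boxtimes B$ is the multi-set in which each element of $B$ is repeated $c$ times; unions are multi-set unions. Let $\mathcal{B}=\{B_i : 1\le i\le m\}$ be a family of pairwise disjoint nonempty subsets of $G$ with $k_i=|B_i|$. $\mathcal{B}$ is an $(n,m;k_1,\dots,k_m;\lambda_1,\dots,\lambda_m)$-generalized strong external difference family (GSEDF) if for each $1\le i\le m$, $\bigcup_{1\le j\le m,\ j\ne i}D(B_i,B_j)=\lambda_i\boxtimes(G\setminus\{0\})$. With $K=(k_1,\dots,k_m)$, $a=\sum_i k_i$, $\widetilde{k}=\mathrm{lcm}(k_1,\dots,k_m)$ and $\widetilde{B}_i=\frac{\widetilde{k}}{k_i}\boxtimes B_i$, $\mathcal{B}$ is an $(n,m,K,a,\lambda)$-SWEDF (standard weighted external difference family), $\lambda$ a positive integer, if $\bigcup_{1\le i\ne j\le m}D(B_i,\widetilde{B}_j)=\lambda\boxtimes(G\setminus\{0\})$.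 *)

theory Defs
  imports Main "HOL-Library.Multiset" "HOL-Library.Disjoint_Sets" "HOL-Library.Cardinality"
begin

text \<open>
  The finite additive Abelian group \<open>G\<close> is the carrier of a type of class \<open>ab_group_add\<close> and
  \<open>finite\<close>.  A family \<open>B\<^sub>1, \<dots>, B\<^sub>m\<close> and its parameters are functions on \<open>nat\<close> of which only the
  values on \<open>{1..m}\<close> matter.  The multiset union of the paper adds multiplicities, so it is
  \<open>+\<close> (and \<open>\<Sum>\<close>) on multisets, not \<open>\<union>#\<close>; the multiset \<open>c \<boxtimes> B\<close> is \<open>repeat_mset c B\<close>.
\<close>

definition diff_mset :: "'a::ab_group_add multiset \<Rightarrow> 'a multiset \<Rightarrow> 'a multiset" where
  "diff_mset B1 B2 = (\<Sum>x\<in>#B1. {#x - y. y \<in># B2#})"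

definition nonzero_mset :: "'a::{ab_group_add, finite} multiset" where
  "nonzero_mset = mset_set (UNIV - {0})"

definition disjoint_blocks ::
  "nat \<Rightarrow> nat \<Rightarrow> (nat \<Rightarrow> nat) \<Rightarrow> (nat \<Rightarrow> 'a::{ab_group_add, finite} set) \<Rightarrow> bool" where
  "disjoint_blocks n m k B \<longleftrightarrow>
     CARD('a) = n \<and> disjoint_family_on B {1..m} \<and>
     (\<forall>i\<in>{1..m}. B i \<noteq> {} \<and> card (B i) = k i)"

definition GSEDF ::
  "nat \<Rightarrow> nat \<Rightarrow> (nat \<Rightarrow> nat) \<Rightarrow> (nat \<Rightarrow> nat) \<Rightarrow> (nat \<Rightarrow> 'a::{ab_group_add, finite} set) \<Rightarrow> bool" where
  "GSEDF n m k l B \<longleftrightarrow>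
     disjoint_blocks n m k B \<and>
     (\<forall>i\<in>{1..m}.
        (\<Sum>j\<in>{1..m} - {i}. diff_mset (mset_set (B i)) (mset_set (B j))) =
          repeat_mset (l i) nonzero_mset)"

definition lcm_sizes :: "nat \<Rightarrow> (nat \<Rightarrow> nat) \<Rightarrow> nat" where
  "lcm_sizes m k = Lcm (k ` {1..m})"

text \<open>All divisions by \<open>k i\<close> below, for \<open>i \<in> {1..m}\<close>, are exact:\<close>

lemma size_dvd_lcm_sizes: "i \<in> {1..m} \<Longrightarrow> k i dvd lcm_sizes m k"
  unfolding lcm_sizes_def by (rule dvd_Lcm) simp

definition weighted_block ::
  "nat \<Rightarrow> (nat \<Rightarrow> nat) \<Rightarrow> (nat \<Rightarrow> 'a set) \<Rightarrow> nat \<Rightarrow> 'a multiset" where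
  "weighted_block m k B i = repeat_mset (lcm_sizes m k div k i) (mset_set (B i))"

definition SWEDF ::
  "nat \<Rightarrow> nat \<Rightarrow> (nat \<Rightarrow> nat) \<Rightarrow> nat \<Rightarrow> nat \<Rightarrow> (nat \<Rightarrow> 'a::{ab_group_add, finite} set) \<Rightarrow> bool" where
  "SWEDF n m k a l B \<longleftrightarrow>
     disjoint_blocks n m k B \<and> a = (\<Sum>i\<in>{1..m}. k i) \<and> l > 0 \<and>
     (\<Sum>(i, j)\<in>{(i, j). i \<in> {1..m} \<and> j \<in> {1..m} \<and> i \<noteq> j}.
        diff_mset (mset_set (B i)) (weighted_block m k B j)) =
       repeat_mset l nonzero_mset"

end

theory Submission
  imports Defs
begin

text \<open>
  Negation turns \<open>D(X, Y)\<close> into \<open>D(Y, X)\<close> and fixes \<open>G \<setminus> {0}\<close>.  Hence the GSEDF condition at \<open>j\<close>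
  also says that the \<open>D(B\<^sub>i, B\<^sub>j)\<close> with \<open>i \<noteq> j\<close> add up to \<open>l\<^sub>j\<close> copies of \<open>G \<setminus> {0}\<close>; the weights depend on
  \<open>j\<close> only, so grouping the SWEDF sum by \<open>j\<close> gives the result.
\<close>

lemma diff_mset_empty_left [simp]: "diff_mset {#} Y = {#}"
  by (simp add: diff_mset_def)

lemma diff_mset_add_left:
  "diff_mset (add_mset x X) Y = {#x - y. y \<in># Y#} + diff_mset X Y"
  by (simp add: diff_mset_def)

lemma diff_mset_empty_right [simp]: "diff_mset X {#} = {#}"
  by (induction X) (simp_all add: diff_mset_add_left)

lemma diff_mset_add_right:
  "diff_mset X (add_mset y Y) = {#x - y. x \<in># X#} + diff_mset X Y"
  by (induction X) (simp_all add: diff_mset_add_left)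

lemma diff_mset_union_right: "diff_mset X (Y + Z) = diff_mset X Y + diff_mset X Z"
  by (induction Y) (simp_all add: diff_mset_add_right)

lemma diff_mset_repeat_right: "diff_mset X (repeat_mset c Y) = repeat_mset c (diff_mset X Y)"
  by (induction c) (simp_all add: diff_mset_union_right)

lemma image_uminus_diff_mset: "image_mset uminus (diff_mset X Y) = diff_mset Y X"
  by (induction X)
    (simp_all add: diff_mset_add_left diff_mset_add_right image_mset.compositionality o_def)

text \<open>Serves to show that the differences between two nonempty blocks cannot form an empty
  multiset.\<close>

lemma size_diff_mset: "size (diff_mset X Y) = size X * size Y"
  by (induction X) (simp_all add: diff_mset_add_left)

lemma image_uminus_nonzero_mset: "image_mset uminus nonzero_mset = nonzero_mset"
proof -
  have "uminus ` (UNIV - {0::'a}) = UNIV - {0}"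
    by (auto intro: image_eqI[where x = "- x" for x])
  then show ?thesis
    unfolding nonzero_mset_def by (simp add: image_mset_mset_set)
qed

lemma image_mset_sum: "image_mset f (\<Sum>i\<in>I. M i) = (\<Sum>i\<in>I. image_mset f (M i))"
  by (induction I rule: infinite_finite_induct) simp_all

lemma image_mset_repeat_mset: "image_mset f (repeat_mset c M) = repeat_mset c (image_mset f M)"
  by (induction c) simp_all

lemma repeat_mset_sum_left: "repeat_mset (\<Sum>i\<in>I. c i) M = (\<Sum>i\<in>I. repeat_mset (c i) M)"
  by (induction I rule: infinite_finite_induct) (simp_all add: repeat_mset_distrib)

lemma repeat_mset_sum_right: "repeat_mset c (\<Sum>i\<in>I. M i) = (\<Sum>i\<in>I. repeat_mset c (M i))"
  by (induction I rule: infinite_finite_induct) (simp_all add: repeat_mset_distrib2)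

lemma GSEDF_sum_left:
  assumes "GSEDF n m k l B" and "j \<in> {1..m}"
  shows "(\<Sum>i\<in>{1..m} - {j}. diff_mset (mset_set (B i)) (mset_set (B j))) =
    repeat_mset (l j) nonzero_mset"
proof -
  have "(\<Sum>i\<in>{1..m} - {j}. diff_mset (mset_set (B j)) (mset_set (B i))) =
      repeat_mset (l j) nonzero_mset"
    using assms by (auto simp: GSEDF_def)
  from arg_cong[OF this, of "image_mset uminus"] show ?thesis
    by (simp only: image_mset_sum image_uminus_diff_mset image_mset_repeat_mset
        image_uminus_nonzero_mset)
qed

lemma disjoint_blocks_size_pos:
  assumes "disjoint_blocks n m k B" and "i \<in> {1..m}"
  shows "k i > 0"
  using assms unfolding disjoint_blocks_def by (metis card_gt_0_iff finite)

text \<open>Supplies the positivity of \<lambda> that \<open>SWEDF\<close> demands. As m \<ge> 2,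
  there is a block \<open>B j\<close> with j \<noteq> i, and \<open>l i = 0\<close> would force
  D(\<open>B i\<close>, \<open>B j\<close>) to be empty although it has |\<open>B i\<close>|
  |\<open>B j\<close>| > 0 elements.\<close>

lemma GSEDF_multiplicity_pos:
  assumes "m \<ge> 2" and "GSEDF n m k l B" and i: "i \<in> {1..m}"
  shows "l i > 0"
proof (rule ccontr)
  assume "\<not> l i > 0"
  define j where "j = (if i = 1 then 2 else 1 :: nat)"
  have j: "j \<in> {1..m} - {i}"
    using \<open>m \<ge> 2\<close> by (auto simp: j_def)
  have "(\<Sum>j\<in>{1..m} - {i}. diff_mset (mset_set (B i)) (mset_set (B j))) = {#}"
    using assms \<open>\<not> l i > 0\<close> by (auto simp: GSEDF_def)
  \<comment> \<open>A sum of multisets is empty only if every summand is.\<close>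
  then have "diff_mset (mset_set (B i)) (mset_set (B j)) = {#}"
    using j by (simp add: sum.remove)
  then have "card (B i) * card (B j) = 0"
    using size_diff_mset[of "mset_set (B i)" "mset_set (B j)"] by simp
  moreover have "card (B i) > 0" "card (B j) > 0"
    using assms(2) i j disjoint_blocks_size_pos[of n m k B]
    by (auto simp: GSEDF_def disjoint_blocks_def)
  ultimately show False
    by auto
qed

theorem lemma5:
  fixes B :: "nat \<Rightarrow> 'a::{ab_group_add, finite} set"
    and n m :: nat
    and k l :: "nat \<Rightarrow> nat"
  assumes "m \<ge> 2"
    and "GSEDF n m k l B"
  shows "SWEDF n m k (\<Sum>i\<in>{1..m}. k i) (\<Sum>i\<in>{1..m}. (l i * lcm_sizes m k) div k i) B"
proof -
  let ?I = "{1..m}"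
  let ?D = "\<lambda>i j. diff_mset (mset_set (B i)) (mset_set (B j))"
  define w where "w j = lcm_sizes m k div k j" for j
  have blocks: "disjoint_blocks n m k B"
    using assms(2) by (simp add: GSEDF_def)
  have k_pos: "k i > 0" if "i \<in> ?I" for i
    using blocks that by (rule disjoint_blocks_size_pos)
  \<comment> \<open>The lcm of finitely many positive numbers is nonzero. Each \<open>k i\<close>
    divides it and is therefore at most the lcm, so every weight is at least 1.\<close>
  have "lcm_sizes m k \<noteq> 0"
    unfolding lcm_sizes_def using k_pos by (subst Lcm_0_iff) fastforce+
  then have w_pos: "w i > 0" if "i \<in> ?I" for i
    using k_pos[OF that] dvd_imp_le[OF size_dvd_lcm_sizes[OF that, of k]]
    by (simp add: w_def div_greater_zero_iff)
  \<comment> \<open>\<open>k i\<close> divides the lcm, so dividing the whole product amounts to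
    dividing the lcm alone, which gives the weight.\<close>
  have lw: "l i * lcm_sizes m k div k i = w i * l i" if "i \<in> ?I" for i
    using size_dvd_lcm_sizes[OF that, of k] by (simp add: w_def div_mult_swap mult.commute)
  have "(\<Sum>i\<in>?I. w i * l i) > 0"
    using assms(1) w_pos GSEDF_multiplicity_pos[OF assms] by (intro sum_pos) auto
  moreover have "(\<Sum>(i, j)\<in>{(i, j). i \<in> ?I \<and> j \<in> ?I \<and> i \<noteq> j}.
      diff_mset (mset_set (B i)) (weighted_block m k B j)) =
      repeat_mset (\<Sum>j\<in>?I. w j * l j) nonzero_mset"
  proof -
    have "(\<Sum>(i, j)\<in>{(i, j). i \<in> ?I \<and> j \<in> ?I \<and> i \<noteq> j}.
        diff_mset (mset_set (B i)) (weighted_block m k B j)) =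
        (\<Sum>(j, i)\<in>(SIGMA j:?I. ?I - {j}). repeat_mset (w j) (?D i j))"
      \<comment> \<open>Swapping the pair makes j the outer index, so that the weight
        \<open>w j\<close> is constant on each inner sum and can be pulled out of it.\<close>
      by (rule sum.reindex_bij_witness[of _ prod.swap prod.swap])
        (auto simp: weighted_block_def w_def diff_mset_repeat_right)
    also have "\<dots> = (\<Sum>j\<in>?I. repeat_mset (w j) (\<Sum>i\<in>?I - {j}. ?D i j))"
      by (simp add: sum.Sigma repeat_mset_sum_right)
    \<comment> \<open>Each inner sum has the fixed block on the right of the differences, hence
      \<open>GSEDF_sum_left\<close>; the nested repetitions then multiply.\<close>
    also have "\<dots> = (\<Sum>j\<in>?I. repeat_mset (w j * l j) nonzero_mset)"
      using assms(2) by (intro sum.cong refl) (simp only: GSEDF_sum_left repeat_mset_right)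
    finally show ?thesis
      by (simp add: repeat_mset_sum_left)
  qed
  ultimately show ?thesis
    using blocks lw by (simp add: SWEDF_def)
qed

end
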